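(* Let $n\ge 2$, let $K\subset\mathbb{R}^n$ be an $o$-symmetric convex body with non-empty interior, let $\Lambda\subset\mathbb{R}^n$ be a lattice of rank $n$, and let $\Lambda_1\subsetneq\Lambda$ be a proper sublattice of rank $n$. Then $$\lambda_1(K,\Lambda\setminus\Lambda_1)\le\frac{2^n\det\Lambda}{\lambda_1(K,\Lambda_1)^{n-1}\operatorname{vol}(K)}+\lambda_1(K,\Lambda).$$
   Context: An $o$-symmetric convex body is a compact convex set $K\subset\mathbb{R}^n$ with $K=-K$; $\operatorname{vol}$ is $n$-dimensional Lebesgue measure. A lattice $\Lambda\subset\mathbb{R}^n$ is a discrete additive subgroup (the $\mathbb{Z}$-span of $r$ linearly independent vectors, $r=\operatorname{rank}\Lambda\le n$); $\det\Lambda$ is the $r$-dimensional volume of a fundamental cell of $\Lambda$. For a set $X\subset\mathbb{R}^n$, $\dim X$ denotes here the dimension of its linear span (the maximal number of linearly independent points of $X$). The successive minima are $\lambda_i(K,\Lambda)=\min\{\lambda\ge 0:\dim(\lambda K\cap\Lambda)\ge i\}$ for $1\le i\le\operatorname{rank}\Lambda$. For a sublattice $\Lambda_1\subsetneq\Lambda$ the $j$-th restricted successive minimum is $\lambda_j(K,\Lambda\setminus\Lambda_1)=\min\{\lambda\ge 0:\dim(\lambda K\cap(\Lambda\setminus\Lambda_1))\ge j\}$ for $1\le j\le\operatorname{rank}\Lambda$. *)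

theory Defs
  imports "HOL-Analysis.Analysis"
begin

definition o_symmetric_convex_body :: "'a::euclidean_space set \<Rightarrow> bool" where
  "o_symmetric_convex_body K \<longleftrightarrow> compact K \<and> convex K \<and> K = uminus ` K"

text \<open>The rank of a lattice \<open>\<Lambda>\<close> is the dimension \<open>dim \<Lambda>\<close> of its linear span.\<close>

definition is_lattice :: "'a::euclidean_space set \<Rightarrow> bool" where
  "is_lattice \<Lambda> \<longleftrightarrow>
     0 \<in> \<Lambda> \<and> (\<forall>x\<in>\<Lambda>. \<forall>y\<in>\<Lambda>. x + y \<in> \<Lambda>) \<and> (\<forall>x\<in>\<Lambda>. - x \<in> \<Lambda>) \<and> discrete \<Lambda>"

definition int_span :: "'a::euclidean_space set \<Rightarrow> 'a set" where
  "int_span B = {(\<Sum>b\<in>B. real_of_int (c b) *\<^sub>R b) | c :: 'a \<Rightarrow> int. True}"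

definition lattice_basis :: "'a::euclidean_space set \<Rightarrow> 'a set \<Rightarrow> bool" where
  "lattice_basis B \<Lambda> \<longleftrightarrow> independent B \<and> int_span B = \<Lambda>"

definition fundamental_cell :: "'a::euclidean_space set \<Rightarrow> 'a set" where
  "fundamental_cell B =
     {(\<Sum>b\<in>B. c b *\<^sub>R b) | c :: 'a \<Rightarrow> real. \<forall>b\<in>B. 0 \<le> c b \<and> c b < 1}"

text \<open>
  Only meaningful for lattices of full rank, where the volume of a cell is the Lebesgue measure
  of the ambient space. The volume does not depend on the chosen basis.
\<close>

definition lattice_det :: "'a::euclidean_space set \<Rightarrow> real" where
  "lattice_det \<Lambda> = measure lebesgue (fundamental_cell (SOME B. lattice_basis B \<Lambda>))"

text \<open>
  The set \<open>S\<close> is a lattice \<open>\<Lambda>\<close> for the ordinary successive minima and a difference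
  \<open>\<Lambda> - \<Lambda>\<^sub>1\<close> for the restricted ones. \<open>LEAST\<close> denotes the minimum in the reals
  (not merely the infimum); \<open>dim\<close> is the dimension of the linear span.
\<close>

definition successive_min :: "nat \<Rightarrow> 'a::euclidean_space set \<Rightarrow> 'a set \<Rightarrow> real" where
  "successive_min i K S = (LEAST t::real. 0 \<le> t \<and> i \<le> dim ((\<lambda>x. t *\<^sub>R x) ` K \<inter> S))"

end

theory Submission
  imports Defs
begin

text \<open>
  Write \<open>l\<close> and \<open>\<mu>\<close> for the first minima of \<open>\<Lambda>\<close> and of \<open>\<Lambda> - \<Lambda>\<^sub>1\<close>, and let \<open>v\<close> attain \<open>\<mu>\<close>. If
  \<open>l\<close> is attained outside \<open>\<Lambda>\<^sub>1\<close>, then \<open>\<mu> \<le> l\<close>. Otherwise \<open>l\<close> is also the first minimum of \<open>\<Lambda>\<^sub>1\<close>.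
  Every point of \<open>v + \<Lambda>\<^sub>1\<close> has norm at least \<open>\<mu>\<close>, so by the triangle inequality the segment from
  \<open>0\<close> to \<open>v\<close> is a shortest path modulo \<open>\<Lambda>\<^sub>1\<close>. With \<open>k = \<lfloor>\<mu> / l\<rfloor>\<close>, the points
  \<open>(j l / \<mu>) v\<close> for \<open>0 \<le> j < k\<close> therefore have pairwise distance at least \<open>l\<close> modulo \<open>\<Lambda>\<close>, and the
  \<open>k\<close> translates of \<open>(l / 2) K\<close> centred there pack under \<open>\<Lambda>\<close>. Hence
  \<open>k (l / 2)\<^sup>n vol K \<le> det \<Lambda>\<close>, and \<open>\<mu> - l < k l\<close>.
\<close>

section \<open>Integer multiples and discreteness in lattices\<close>

lemma is_lattice_diff:
  assumes "is_lattice \<Lambda>" "x \<in> \<Lambda>" "y \<in> \<Lambda>"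
  shows "x - y \<in> \<Lambda>"
  using assms unfolding is_lattice_def by (metis add_uminus_conv_diff)

lemma is_lattice_scale_nat:
  assumes "is_lattice \<Lambda>" "x \<in> \<Lambda>"
  shows "of_nat n *\<^sub>R x \<in> \<Lambda>"
  by (induction n) (use assms in \<open>auto simp: is_lattice_def scaleR_add_left\<close>)

lemma is_lattice_scale_int:
  assumes "is_lattice \<Lambda>" "x \<in> \<Lambda>"
  shows "of_int n *\<^sub>R x \<in> \<Lambda>"
proof (cases n)
  case (nonneg m)
  then show ?thesis using is_lattice_scale_nat[OF assms] by simp
next
  case (neg m)
  have "- (of_nat (Suc m) *\<^sub>R x) \<in> \<Lambda>"
    using is_lattice_scale_nat[OF assms] assms(1) unfolding is_lattice_def by blast
  then show ?thesis using neg by (simp del: of_nat_Suc)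
qed

text \<open>Differences of lattice points are lattice points, so the isolation radius at the origin
  serves at every point.\<close>

lemma is_lattice_uniform_discrete:
  assumes "is_lattice \<Lambda>"
  shows "uniform_discrete \<Lambda>"
proof -
  have "0 isolated_in \<Lambda>"
    using assms by (auto simp: is_lattice_def discrete_def)
  then obtain e where e: "e > 0" "\<And>y. y \<in> \<Lambda> \<Longrightarrow> dist 0 y < e \<Longrightarrow> y = 0"
    by (auto simp: isolated_in_dist_Ex_iff)
  show ?thesis
  proof (rule uniformI1[OF e(1)])
    fix x y assume "x \<in> \<Lambda>" "y \<in> \<Lambda>" "dist x y < e"
    then show "x = y"
      using e(2)[of "x - y"] is_lattice_diff[OF assms, of x y] by (simp add: dist_norm norm_minus_commute)
  qed
qed

text \<open>Uniform discreteness passes to subsets, so sets that are not subgroups, such as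
  \<open>\<Lambda> - \<Lambda>\<^sub>1\<close>, are closed too. This is what makes minima over them
  attained.\<close>

lemma closed_subset_lattice:
  assumes "is_lattice \<Lambda>" "S \<subseteq> \<Lambda>"
  shows "closed S"
  using uniform_discrete_subset[OF is_lattice_uniform_discrete[OF assms(1)] assms(2)]
  by (rule uniform_discrete_imp_closed)

section \<open>Integer spans and reduction modulo a fundamental cell\<close>

lemma int_span_memI: "(\<Sum>b\<in>B. of_int (c b) *\<^sub>R b) \<in> int_span B"
  by (auto simp: int_span_def)

lemma int_span_subset_span: "int_span B \<subseteq> span B"
  by (auto simp: int_span_def intro!: span_sum span_scale intro: span_base)

lemma int_span_subset_lattice:
  assumes "is_lattice \<Lambda>" "B \<subseteq> \<Lambda>"
  shows "int_span B \<subseteq> \<Lambda>"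
proof -
  have "(\<Sum>b\<in>C. of_int (c b) *\<^sub>R b) \<in> \<Lambda>" if "C \<subseteq> \<Lambda>" "finite C" for c and C :: "'a set"
    using that(2,1)
  proof induction
    case empty
    then show ?case using assms(1) by (simp add: is_lattice_def)
  next
    case (insert x F)
    then show ?case
      using assms(1) is_lattice_scale_int[OF assms(1), of x "c x"] by (simp add: is_lattice_def)
  qed
  moreover have "0 \<in> \<Lambda>" using assms(1) by (simp add: is_lattice_def)
  ultimately show ?thesis
    using assms(2) by (cases "finite B") (auto simp: int_span_def)
qed

text \<open>Split each coordinate into its floor and its fractional part.\<close>

lemma fundamental_cell_reduction:
  assumes "finite B" "y \<in> span B"
  obtains z where "z \<in> int_span B" "y - z \<in> fundamental_cell B"
proof -
  obtain u where u: "y = (\<Sum>b\<in>B. u b *\<^sub>R b)"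
    using assms by (auto simp: span_finite)
  have "y - (\<Sum>b\<in>B. of_int \<lfloor>u b\<rfloor> *\<^sub>R b) = (\<Sum>b\<in>B. frac (u b) *\<^sub>R b)"
    by (simp add: u frac_def scaleR_diff_left sum_subtractf)
  moreover have "(\<Sum>b\<in>B. frac (u b) *\<^sub>R b) \<in> fundamental_cell B"
    unfolding fundamental_cell_def
    by (rule CollectI, rule exI[of _ "\<lambda>b. frac (u b)"]) (simp add: frac_lt_1)
  ultimately show ?thesis
    using that[OF int_span_memI[of "\<lambda>b. \<lfloor>u b\<rfloor>"]] by simp
qed

lemma norm_fundamental_cell_le:
  assumes "y \<in> fundamental_cell B"
  shows "norm y \<le> (\<Sum>b\<in>B. norm b)"
proof -
  obtain c where c: "y = (\<Sum>b\<in>B. c b *\<^sub>R b)" "\<And>b. b \<in> B \<Longrightarrow> 0 \<le> c b \<and> c b < 1"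
    using assms by (auto simp: fundamental_cell_def)
  show ?thesis unfolding c(1)
    by (rule sum_norm_le) (use c(2) in \<open>auto intro!: mult_left_le_one_le dest: less_imp_le\<close>)
qed

section \<open>Existence of a lattice basis\<close>

text \<open>Adjoining \<open>b\<close> itself may miss lattice points between the layers parallel to
  \<open>span B\<close>. The vector \<open>c\<close> is taken instead from the lowest layer of
  positive height, and division with remainder by its height then reaches every lattice
  point.\<close>

lemma lattice_basis_extend:
  assumes L: "is_lattice \<Lambda>" and B: "finite B" "independent B" "int_span B = \<Lambda> \<inter> span B"
    and b: "b \<in> \<Lambda>" "b \<notin> span B"
  obtains c where "independent (insert c B)" "span (insert c B) = span (insert b B)"
    "int_span (insert c B) = \<Lambda> \<inter> span (insert b B)"
proof -
  have ind: "independent (insert b B)"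
    using B(2) b(2) by (simp add: independent_insertI)
  \<comment> \<open>On \<open>span (insert b B)\<close>, \<open>f\<close> is the coordinate along
    \<open>b\<close>, and its kernel there is \<open>span B\<close>.\<close>
  obtain f :: "'a \<Rightarrow> real" where f: "linear f" "\<And>x. x \<in> insert b B \<Longrightarrow> f x = (if x = b then 1 else 0)"
    using linear_independent_extend[OF ind, of "\<lambda>x. if x = b then 1 else 0"] by blast
  interpret f: linear f by (fact f(1))
  have "b \<notin> B" using b(2) span_base by blast
  have fb: "f b = 1" using f(2) by simp
  have f0: "f x = 0" if "x \<in> span B" for x
  proof (rule linear_eq_0_on_span[OF f(1) _ that])
    fix x assume "x \<in> B"
    then show "f x = 0" using f(2)[of x] \<open>b \<notin> B\<close> by auto
  qed
  have decomp: "x - f x *\<^sub>R b \<in> span B" if x: "x \<in> span (insert b B)" for x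
  proof -
    obtain k where k: "x - k *\<^sub>R b \<in> span B"
      using x by (auto simp: span_insert)
    have "f x - k = 0"
      using f0[OF k] by (simp add: f.diff f.scale fb)
    then show ?thesis using k by simp
  qed
  define P where "P = {x \<in> \<Lambda> \<inter> span (insert b B). f x > 0}"
  \<comment> \<open>\<open>R\<close> bounds every point whose \<open>b\<close>-coordinate lies
    between 0 and 1 and whose component in \<open>span B\<close> lies in the cell.\<close>
  define R where "R = norm b + (\<Sum>b\<in>B. norm b)"
  have "norm b \<le> R" unfolding R_def by (simp add: sum_nonneg)
  have bP: "b \<in> P" using b fb by (simp add: P_def span_base)
  have "closed P" by (rule closed_subset_lattice[OF L]) (auto simp: P_def)
  then have "compact (P \<inter> cball 0 R)" by (simp add: closed_Int_compact)
  moreover have "P \<inter> cball 0 R \<noteq> {}" using bP \<open>norm b \<le> R\<close> by auto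
  moreover have "continuous_on (P \<inter> cball 0 R) f"
    by (intro linear_continuous_on linear_conv_bounded_linear[THEN iffD1] f(1))
  ultimately obtain c where c: "c \<in> P" "norm c \<le> R" "\<And>x. x \<in> P \<Longrightarrow> norm x \<le> R \<Longrightarrow> f c \<le> f x"
    using continuous_attains_inf[of "P \<inter> cball 0 R" f] by force
  have c_pos: "f c > 0" and cL: "c \<in> \<Lambda>" and c_span: "c \<in> span (insert b B)"
    using c(1) by (auto simp: P_def)
  \<comment> \<open>Searching inside the ball loses nothing. If \<open>f x \<le> 1\<close>,
    subtracting a point of \<open>int_span B\<close> preserves \<open>f x\<close> and brings
    \<open>x\<close> into the ball; otherwise \<open>b\<close>, of height 1, is a better
    competitor.\<close>
  have c_min: "f c \<le> f x" if x: "x \<in> P" for x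
  proof (cases "f x \<le> 1")
    case True
    have xs: "x \<in> \<Lambda>" "x \<in> span (insert b B)" "f x > 0" using x by (auto simp: P_def)
    obtain z where z: "z \<in> int_span B" "x - f x *\<^sub>R b - z \<in> fundamental_cell B"
      using fundamental_cell_reduction[OF B(1) decomp[OF xs(2)]] .
    have zL: "z \<in> \<Lambda>" "z \<in> span B" using z B(3) by auto
    have fxz: "f (x - z) = f x" using f0[OF zL(2)] by (simp add: f.diff)
    have "z \<in> span (insert b B)" using zL(2) span_mono[of B "insert b B"] by auto
    then have "x - z \<in> P"
      using xs zL is_lattice_diff[OF L] fxz by (auto simp: P_def intro: span_diff)
    moreover have "norm (x - z) \<le> R"
    proof -
      have "norm (x - z) \<le> norm (f x *\<^sub>R b) + norm (x - f x *\<^sub>R b - z)"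
        using norm_triangle_ineq[of "f x *\<^sub>R b" "x - f x *\<^sub>R b - z"] by (simp add: algebra_simps)
      also have "norm (f x *\<^sub>R b) \<le> norm b"
        using True xs(3) by (simp add: mult_left_le_one_le)
      finally show ?thesis
        using norm_fundamental_cell_le[OF z(2)] by (simp add: R_def)
    qed
    ultimately show ?thesis using c(3)[of "x - z"] fxz by simp
  next
    case False
    then show ?thesis using c(3)[OF bP \<open>norm b \<le> R\<close>] fb by simp
  qed
  have c_notin: "c \<notin> span B" using f0[of c] c_pos by auto
  have cB: "c \<notin> B" using c_notin span_base by blast
  have span_eq: "span (insert c B) = span (insert b B)"
  proof
    show "span (insert c B) \<subseteq> span (insert b B)"
      using c_span by (intro span_minimal) (auto intro: span_base)
    have "c - f c *\<^sub>R b \<in> span (insert c B)"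
      using decomp[OF c_span] span_mono[OF subset_insertI[of B c]] by blast
    then have "c - (c - f c *\<^sub>R b) \<in> span (insert c B)"
      by (rule span_diff[OF span_base[OF insertI1]])
    then have "b \<in> span (insert c B)"
      using c_pos span_scale[of "f c *\<^sub>R b" _ "1 / f c"] by simp
    then show "span (insert b B) \<subseteq> span (insert c B)"
      by (intro span_minimal) (auto intro: span_base)
  qed
  have B_subset: "B \<subseteq> \<Lambda>"
  proof
    fix x assume "x \<in> B"
    then have "x = (\<Sum>b\<in>B. of_int (if b = x then 1 else 0) *\<^sub>R b)"
      using B(1) by (simp add: if_distrib[of real_of_int] if_distrib[of "\<lambda>c. c *\<^sub>R _"] cong: if_cong)
    then have "x \<in> int_span B" by (metis int_span_memI)
    then show "x \<in> \<Lambda>" using B(3) by auto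
  qed
  have "int_span (insert c B) = \<Lambda> \<inter> span (insert b B)"
  proof
    show "int_span (insert c B) \<subseteq> \<Lambda> \<inter> span (insert b B)"
      using int_span_subset_span[of "insert c B"] int_span_subset_lattice[OF L, of "insert c B"]
        B_subset cL span_eq by auto
    show "\<Lambda> \<inter> span (insert b B) \<subseteq> int_span (insert c B)"
    proof
      fix x assume x: "x \<in> \<Lambda> \<inter> span (insert b B)"
      \<comment> \<open>The remainder \<open>y\<close> has height at least 0 and less than
        \<open>f c\<close>. By minimality the height is 0, so \<open>y\<close> lies in
        \<open>span B\<close>, where \<open>B\<close> is already a basis.\<close>
      define q where "q = \<lfloor>f x / f c\<rfloor>"
      define y where "y = x - of_int q *\<^sub>R c"
      have yL: "y \<in> \<Lambda>" "y \<in> span (insert b B)"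
        using x c_span is_lattice_diff[OF L] is_lattice_scale_int[OF L cL]
        by (auto simp: y_def intro!: span_diff span_scale)
      have fy: "f y = f x - of_int q * f c" by (simp add: y_def f.diff f.scale)
      have "of_int q \<le> f x / f c" "f x / f c < of_int q + 1"
        unfolding q_def by linarith+
      then have "0 \<le> f y" "f y < f c" using c_pos by (auto simp: fy field_simps)
      then have "f y = 0" using c_min[of y] yL by (force simp: P_def)
      then have "y \<in> span B" using decomp[OF yL(2)] by simp
      then have "y \<in> int_span B" using yL(1) B(3) by auto
      then obtain d :: "'a \<Rightarrow> int" where d: "y = (\<Sum>b\<in>B. of_int (d b) *\<^sub>R b)"
        by (auto simp: int_span_def)
      have "x = (\<Sum>b\<in>insert c B. of_int ((d(c := q)) b) *\<^sub>R b)"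
      proof -
        have "(\<Sum>b\<in>B. of_int ((d(c := q)) b) *\<^sub>R b) = y"
          unfolding d using cB by (intro sum.cong) auto
        then show ?thesis using B(1) cB by (simp add: y_def)
      qed
      then show "x \<in> int_span (insert c B)" by (metis int_span_memI)
    qed
  qed
  then show ?thesis
    using that[OF _ span_eq] B(2) c_notin by (simp add: independent_insertI)
qed

text \<open>Induction along a maximal independent set \<open>C\<close> of lattice points. The basis
  \<open>B\<close> need not consist of points of \<open>C\<close>; only the span is carried along.
  This justifies the choice made in \<open>lattice_det\<close>.\<close>

lemma lattice_basis_exists:
  assumes L: "is_lattice \<Lambda>"
  shows "\<exists>B. lattice_basis B \<Lambda>"
proof -
  have *: "\<exists>B. finite B \<and> independent B \<and> span B = span C \<and> int_span B = \<Lambda> \<inter> span C"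
    if "finite C" "independent C" "C \<subseteq> \<Lambda>" for C
    using that
  proof induction
    case empty
    show ?case
      by (rule exI[of _ "{}"]) (use L in \<open>auto simp: int_span_def is_lattice_def independent_empty\<close>)
  next
    case (insert b C)
    then have "independent C" "b \<notin> span C" "C \<subseteq> \<Lambda>" "b \<in> \<Lambda>"
      by (auto simp: independent_insert)
    with insert.IH obtain B
      where B: "finite B" "independent B" "span B = span C" "int_span B = \<Lambda> \<inter> span C"
      by blast
    obtain c where "independent (insert c B)" "span (insert c B) = span (insert b B)"
        "int_span (insert c B) = \<Lambda> \<inter> span (insert b B)"
      using lattice_basis_extend[OF L B(1,2) _ \<open>b \<in> \<Lambda>\<close>] B \<open>b \<notin> span C\<close> by auto
    moreover have "span (insert b B) = span (insert b C)"
      using B(3) by (simp add: span_insert)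
    ultimately show ?case using B(1) by (intro exI[of _ "insert c B"]) auto
  qed
  obtain C where C: "C \<subseteq> \<Lambda>" "independent C" "\<Lambda> \<subseteq> span C"
    using maximal_independent_subset[of \<Lambda>] by blast
  then have "\<Lambda> \<inter> span C = \<Lambda>" by blast
  then show ?thesis
    using *[OF independent_imp_finite[OF C(2)] C(2,1)] by (auto simp: lattice_basis_def)
qed

lemma lattice_basis_some:
  assumes "is_lattice \<Lambda>"
  shows "lattice_basis (SOME B. lattice_basis B \<Lambda>) \<Lambda>"
  using lattice_basis_exists[OF assms] by (rule someI_ex)

section \<open>Packings and the determinant\<close>

text \<open>The cell is bounded, and it is a finite intersection of half-open slabs cut out by the
  coordinate functionals dual to \<open>B\<close>.\<close>

lemma fundamental_cell_lmeasurable: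
  fixes B :: "'a::euclidean_space set"
  assumes "independent B" "span B = UNIV"
  shows "fundamental_cell B \<in> lmeasurable"
proof -
  have fin: "finite B" using assms(1) by (rule independent_imp_finite)
  have "\<exists>f :: 'a \<Rightarrow> real. linear f \<and> (\<forall>x\<in>B. f x = (if x = b then 1 else 0))" for b
    using linear_independent_extend[OF assms(1), of "\<lambda>x. if x = b then 1 else 0"] by blast
  then obtain f :: "'a \<Rightarrow> 'a \<Rightarrow> real" where f: "\<And>b. linear (f b)"
    "\<And>b x. x \<in> B \<Longrightarrow> f b x = (if x = b then 1 else 0)"
    by metis
  have coord: "f b (\<Sum>x\<in>B. c x *\<^sub>R x) = c b" if "b \<in> B" for b c
  proof -
    have "f b (\<Sum>x\<in>B. c x *\<^sub>R x) = (\<Sum>x\<in>B. c x * f b x)"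
      using f(1)[of b] by (simp add: linear_sum linear_cmul)
    also have "\<dots> = (\<Sum>x\<in>B. if x = b then c x else 0)"
      by (intro sum.cong) (auto simp: f(2))
    finally show ?thesis using that fin by simp
  qed
  have "fundamental_cell B = (\<Inter>b\<in>B. {x. 0 \<le> f b x} \<inter> {x. f b x < 1})" (is "_ = ?I")
  proof
    show "fundamental_cell B \<subseteq> ?I" by (auto simp: fundamental_cell_def coord)
    show "?I \<subseteq> fundamental_cell B"
    proof
      fix x assume x: "x \<in> ?I"
      have "x \<in> span B" using assms(2) by simp
      then obtain u where u: "x = (\<Sum>b\<in>B. u b *\<^sub>R b)"
        using fin by (auto simp: span_finite)
      have "\<forall>b\<in>B. 0 \<le> u b \<and> u b < 1" using x coord[of _ u] u by fastforce
      then show "x \<in> fundamental_cell B" using u by (auto simp: fundamental_cell_def)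
    qed
  qed
  moreover have "{x. 0 \<le> f b x} \<inter> {x. f b x < 1} \<in> sets borel" for b
  proof -
    have "continuous_on UNIV (f b)"
      by (intro linear_continuous_on linear_conv_bounded_linear[THEN iffD1] f(1))
    then have "closed {x. 0 \<le> f b x}" "open {x. f b x < 1}"
      by (auto intro!: closed_Collect_le open_Collect_less continuous_intros)
    then show ?thesis by (intro sets.Int) auto
  qed
  ultimately have "fundamental_cell B \<in> sets borel"
    using fin by (cases "B = {}") (auto intro!: sets.finite_INT)
  moreover have "bounded (fundamental_cell B)"
    using norm_fundamental_cell_le by (auto simp: bounded_iff)
  ultimately show ?thesis
    by (intro bounded_set_imp_lmeasurable) auto
qed

text \<open>Cutting \<open>A\<close> along the translates of \<open>F\<close> and moving the pieces back into \<open>F\<close> keeps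
  them disjoint.\<close>

lemma measure_le_of_disjoint_translates:
  fixes A F :: "'a::euclidean_space set"
  assumes A: "A \<in> lmeasurable" and F: "F \<in> lmeasurable" and "countable L"
    and cover: "(\<Union>v\<in>L. (+) v ` F) = UNIV"
    and disj: "\<And>v w x y. \<lbrakk>v \<in> L; w \<in> L; x \<in> A; y \<in> A; x - v = y - w\<rbrakk> \<Longrightarrow> v = w"
  shows "measure lebesgue A \<le> measure lebesgue F"
proof -
  let ?I = "to_nat_on L ` L" and ?g = "from_nat_into L"
  define E where "E i = (if i \<in> ?I then A \<inter> (+) (?g i) ` F else {})" for i
  define E' where "E' i = (if i \<in> ?I then (+) (- ?g i) ` A \<inter> F else {})" for i
  have g: "?g (to_nat_on L v) = v" if "v \<in> L" for v
    using that \<open>countable L\<close> by simp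
  have translate: "(+) (- a) ` (A \<inter> (+) a ` F) = (+) (- a) ` A \<inter> F" for a
    by (force simp: image_iff)
  have meas_E: "E i \<in> sets lebesgue" for i
  proof -
    have "A \<inter> (+) (?g i) ` F \<in> sets lebesgue"
      using A F by (blast intro: sets.Int lebesgue_sets_translation fmeasurableD)
    then show ?thesis unfolding E_def by (metis sets.empty_sets)
  qed
  have meas_E': "E' i \<in> sets lebesgue" for i
  proof -
    have "(+) (- ?g i) ` A \<inter> F \<in> sets lebesgue"
      using A F by (blast intro: sets.Int lebesgue_sets_translation fmeasurableD)
    then show ?thesis unfolding E'_def by (metis sets.empty_sets)
  qed
  have eq: "emeasure lebesgue (E' i) = emeasure lebesgue (E i)" for i
    using emeasure_lebesgue_affine[of 1 "- ?g i" "E i"] translate[of "?g i"]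
    by (auto simp: E_def E'_def add.commute cong: image_cong_simp)
  have "disjoint_family E'"
  proof (unfold disjoint_family_on_def, intro ballI impI equals0I, elim IntE)
    fix i j x assume ij: "i \<noteq> j" "x \<in> E' i" "x \<in> E' j"
    then obtain v w where vw: "v \<in> L" "w \<in> L" "i = to_nat_on L v" "j = to_nat_on L w"
      by (auto simp: E'_def split: if_splits)
    then obtain a b where "a \<in> A" "b \<in> A" "x = - v + a" "x = - w + b"
      using ij by (auto simp: E'_def g)
    then have "v = w" using disj[of v w a b] vw by simp
    then show False using vw ij(1) by simp
  qed
  have "A = (\<Union>i. E i)"
  proof
    show "A \<subseteq> (\<Union>i. E i)"
    proof
      fix x assume "x \<in> A"
      moreover obtain v where "v \<in> L" "x \<in> (+) v ` F" using cover by blast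
      ultimately have "x \<in> E (to_nat_on L v)" by (simp add: E_def g)
      then show "x \<in> (\<Union>i. E i)" by blast
    qed
  qed (auto simp: E_def split: if_splits)
  then have "emeasure lebesgue A \<le> (\<Sum>i. emeasure lebesgue (E i))"
    using emeasure_subadditive_countably[of E lebesgue] meas_E by auto
  also have "\<dots> = emeasure lebesgue (\<Union>i. E' i)"
    using suminf_emeasure[of E' lebesgue] meas_E' \<open>disjoint_family E'\<close> by (auto simp: eq)
  also have "\<dots> \<le> emeasure lebesgue F"
    using F by (intro emeasure_mono) (auto simp: E'_def split: if_splits)
  finally show ?thesis
    using A F by (simp add: emeasure_eq_measure2 measure_nonneg)
qed

text \<open>The lattice translates of a fundamental cell cover the space, while \<open>A\<close>
  contains no two points differing by a nonzero lattice vector, so \<open>A\<close> can be folded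
  into one cell without overlap.\<close>

lemma measure_le_lattice_det:
  fixes A \<Lambda> :: "'a::euclidean_space set"
  assumes L: "is_lattice \<Lambda>" "dim \<Lambda> = DIM('a)" and A: "A \<in> lmeasurable"
    and disj: "\<And>v x y. \<lbrakk>v \<in> \<Lambda>; x \<in> A; y \<in> A; x - y = v\<rbrakk> \<Longrightarrow> v = 0"
  shows "measure lebesgue A \<le> lattice_det \<Lambda>"
proof -
  define B where "B = (SOME B. lattice_basis B \<Lambda>)"
  have B: "independent B" "int_span B = \<Lambda>"
    using lattice_basis_some[OF L(1)] by (auto simp: B_def lattice_basis_def)
  have fin: "finite B" using B(1) by (rule independent_imp_finite)
  have "span \<Lambda> = UNIV" using L(2) by (simp add: dim_eq_full)
  moreover have "span \<Lambda> \<subseteq> span B"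
    using int_span_subset_span[of B] B(2) by (intro span_minimal) auto
  ultimately have span: "span B = UNIV" by auto
  have "countable \<Lambda>"
    using sparse_imp_countable[OF open_UNIV
      uniform_discrete_imp_sparse[OF is_lattice_uniform_discrete[OF L(1)]]] by simp
  have "(\<Union>v\<in>\<Lambda>. (+) v ` fundamental_cell B) = UNIV"
  proof (intro equalityI subset_UNIV subsetI)
    fix y :: 'a
    obtain z where "z \<in> int_span B" "y - z \<in> fundamental_cell B"
      using fundamental_cell_reduction[OF fin, of y] span by auto
    then show "y \<in> (\<Union>v\<in>\<Lambda>. (+) v ` fundamental_cell B)"
      using B(2) by (auto intro!: bexI[of _ z] image_eqI[of _ _ "y - z"])
  qed
  moreover have "v = w" if "v \<in> \<Lambda>" "w \<in> \<Lambda>" "x \<in> A" "y \<in> A" "x - v = y - w" for v w x y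
    using disj[of "v - w" x y] is_lattice_diff[OF L(1)] that by (simp add: algebra_simps)
  ultimately show ?thesis
    using measure_le_of_disjoint_translates[OF A fundamental_cell_lmeasurable[OF B(1) span] \<open>countable \<Lambda>\<close>]
    by (simp add: lattice_det_def B_def)
qed


section \<open>Symmetric convex bodies and their dilates\<close>

text \<open>Triangle inequality for the gauge of \<open>K\<close>, phrased by membership in dilates:
  the rescaled sum is a convex combination with weights proportional to \<open>s\<close> and
  \<open>t\<close>.\<close>

lemma scaled_body_add:
  assumes "convex K" "0 \<le> s" "0 \<le> t" "x \<in> (*\<^sub>R) s ` K" "y \<in> (*\<^sub>R) t ` K"
  shows "x + y \<in> (*\<^sub>R) (s + t) ` K"
proof -
  obtain p q where pq: "x = s *\<^sub>R p" "p \<in> K" "y = t *\<^sub>R q" "q \<in> K"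
    using assms by auto
  show ?thesis
  proof (cases "s + t = 0")
    case True
    then have "s = 0" "t = 0" using assms by auto
    then show ?thesis using pq by auto
  next
    case False
    have "(s / (s + t)) *\<^sub>R p + (t / (s + t)) *\<^sub>R q \<in> K"
      using assms pq False by (intro convexD) (auto simp: add_divide_distrib[symmetric])
    moreover have "x + y = (s + t) *\<^sub>R ((s / (s + t)) *\<^sub>R p + (t / (s + t)) *\<^sub>R q)"
      using False by (simp add: pq scaleR_add_right)
    ultimately show ?thesis by blast
  qed
qed

lemma scaled_body_uminus:
  fixes K :: "'a::real_vector set"
  assumes "K = uminus ` K" "x \<in> (*\<^sub>R) t ` K"
  shows "- x \<in> (*\<^sub>R) t ` K"
proof -
  obtain p where p: "x = t *\<^sub>R p" "p \<in> K" using assms(2) by auto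
  then have "- p \<in> K" using assms(1) by blast
  moreover have "- x = t *\<^sub>R (- p)" by (simp add: p(1))
  ultimately show ?thesis by (rule rev_image_eqI)
qed

lemma interior_symmetric:
  fixes K :: "'a::euclidean_space set"
  assumes "K = uminus ` K" "x \<in> interior K"
  shows "- x \<in> interior K"
proof -
  have "interior K = uminus ` interior K"
    using interior_negations[of K] assms(1) by simp
  then show ?thesis using assms(2) by blast
qed

text \<open>The half difference is the midpoint of \<open>x\<close> and \<open>- y\<close>. It
  controls differences of points taken from two half-size copies of the body.\<close>

lemma interior_half_diff:
  fixes K :: "'a::euclidean_space set"
  assumes "o_symmetric_convex_body K" "x \<in> interior K" "y \<in> interior K"
  shows "(1 / 2) *\<^sub>R (x - y) \<in> interior K"
proof -
  have "(1 / 2) *\<^sub>R x + (1 / 2) *\<^sub>R (- y) \<in> interior K"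
    using assms convex_interior[of K] interior_symmetric[of K y]
    by (intro convexD) (auto simp: o_symmetric_convex_body_def)
  then show ?thesis by (simp add: algebra_simps)
qed

lemma zero_in_interior:
  fixes K :: "'a::euclidean_space set"
  assumes "o_symmetric_convex_body K" "interior K \<noteq> {}"
  shows "0 \<in> interior K"
  using assms interior_half_diff[of K] by fastforce

text \<open>An interior point can be stretched slightly without leaving \<open>K\<close>. The strict
  bound \<open>t < 1\<close> later turns into a distance strictly below the first minimum.\<close>

lemma interior_subset_scaled_body:
  fixes K :: "'a::euclidean_space set"
  assumes "z \<in> interior K"
  obtains t where "0 \<le> t" "t < 1" "z \<in> (*\<^sub>R) t ` K"
proof -
  obtain e where e: "e > 0" "ball z e \<subseteq> K"
    using assms by (auto simp: mem_interior)
  \<comment> \<open>Any positive \<open>s\<close> with \<open>s * norm z < e\<close> would serve;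
    adding 1 keeps the quotient defined at \<open>z = 0\<close>.\<close>
  define s where "s = e / (2 * (norm z + 1))"
  have "norm z + 1 > 0" by (simp add: add_nonneg_pos)
  then have "s > 0" using e by (simp add: s_def)
  have "s * norm z \<le> s * (norm z + 1)" using \<open>s > 0\<close> by simp
  also have "\<dots> = e / 2" using \<open>norm z + 1 > 0\<close> by (simp add: s_def field_simps)
  also have "\<dots> < e" using e by simp
  finally have "s * norm z < e" .
  then have "(1 + s) *\<^sub>R z \<in> ball z e"
    using \<open>s > 0\<close> by (simp add: dist_norm algebra_simps)
  then have "(1 + s) *\<^sub>R z \<in> K" using e by blast
  then show ?thesis
    using \<open>s > 0\<close> by (intro that[of "1 / (1 + s)"]) (auto intro!: image_eqI[of _ _ "(1 + s) *\<^sub>R z"])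
qed

section \<open>Attainment of the first minimum\<close>

text \<open>\<open>LEAST\<close> over the reals says something only if the minimum exists.
  Compactness of \<open>K\<close> and closedness of \<open>S - {0}\<close> provide it, for lattices
  and differences of lattices alike.\<close>

lemma successive_min_one_attained:
  fixes K \<Lambda> S :: "'a::euclidean_space set"
  assumes K: "o_symmetric_convex_body K" "interior K \<noteq> {}"
    and L: "is_lattice \<Lambda>" "S \<subseteq> \<Lambda>" and a: "a \<in> S" "a \<noteq> 0"
  obtains x where "x \<in> S" "x \<noteq> 0" "x \<in> (*\<^sub>R) (successive_min 1 K S) ` K"
    "0 < successive_min 1 K S"
    "\<And>y t. \<lbrakk>y \<in> S; y \<noteq> 0; 0 \<le> t; y \<in> (*\<^sub>R) t ` K\<rbrakk> \<Longrightarrow> successive_min 1 K S \<le> t"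
proof -
  define T where "T = {t. 0 \<le> t \<and> (\<exists>x\<in>S. x \<noteq> 0 \<and> x \<in> (*\<^sub>R) t ` K)}"
  have "1 \<le> dim ((*\<^sub>R) t ` K \<inter> S) \<longleftrightarrow> (\<exists>x\<in>S. x \<noteq> 0 \<and> x \<in> (*\<^sub>R) t ` K)" for t
  proof -
    have "1 \<le> dim ((*\<^sub>R) t ` K \<inter> S) \<longleftrightarrow> \<not> ((*\<^sub>R) t ` K \<inter> S \<subseteq> {0})"
      by (simp add: dim_eq_0[symmetric] Suc_le_eq del: dim_eq_0)
    then show ?thesis by blast
  qed
  then have min_T: "successive_min 1 K S = (LEAST t. t \<in> T)"
    by (simp add: successive_min_def T_def)
  obtain e where e: "e > 0" "cball 0 e \<subseteq> K"
    using zero_in_interior[OF K] by (auto simp: mem_interior_cball)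
  \<comment> \<open>A ball inside \<open>K\<close> makes \<open>t0\<close> an admissible factor, so
    only factors up to \<open>t0\<close> need to be searched.\<close>
  define t0 where "t0 = norm a / e"
  have "t0 > 0" using e a by (simp add: t0_def)
  have "(e / norm a) *\<^sub>R a \<in> K" using e a by (intro subsetD[OF e(2)]) simp
  then have t0: "t0 \<in> T"
    using a \<open>t0 > 0\<close> e
    by (auto simp: T_def t0_def intro!: bexI[of _ a] image_eqI[of _ _ "(e / norm a) *\<^sub>R a"])
  \<comment> \<open>The admissible factors up to \<open>t0\<close> are the projection of a compact
    set of pairs, hence compact.\<close>
  define C where "C = fst ` (({0..t0} \<times> K) \<inter> (\<lambda>(t, y). t *\<^sub>R y) -` (S - {0}))"
  have C: "C = T \<inter> {..t0}" by (force simp: C_def T_def)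
  have "closed (S - {0})" using L by (intro closed_subset_lattice[OF L(1)]) auto
  then have "closed ((\<lambda>(t, y :: 'a). t *\<^sub>R y) -` (S - {0}))"
    by (intro closed_vimage) (auto simp: case_prod_unfold intro!: continuous_intros)
  moreover have "compact K" using K(1) by (simp add: o_symmetric_convex_body_def)
  ultimately have "compact C"
    unfolding C_def
    by (intro compact_continuous_image compact_Int_closed compact_Times continuous_on_fst
        continuous_on_id compact_Icc)
  moreover have "C \<noteq> {}" using t0 C by auto
  ultimately obtain m where m: "m \<in> C" "\<And>t. t \<in> C \<Longrightarrow> m \<le> t"
    using compact_attains_inf[of C] by blast
  have m_le: "m \<le> t" if "t \<in> T" for t
    using m(1) m(2)[of t] that by (cases "t \<le> t0") (auto simp: C)
  have "m \<in> T" using m(1) C by simp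
  then have min_eq: "successive_min 1 K S = m"
    unfolding min_T using m_le by (rule Least_equality)
  obtain x where x: "x \<in> S" "x \<noteq> 0" "x \<in> (*\<^sub>R) m ` K" "0 \<le> m"
    using \<open>m \<in> T\<close> by (auto simp: T_def)
  then have "m \<noteq> 0" by auto
  then show ?thesis
    using x m_le by (intro that[of x, unfolded min_eq]) (auto simp: T_def)
qed

section \<open>Packing copies of the body along a shortest vector\<close>

text \<open>Overlap after a translation by \<open>w\<close> is excluded according to where
  \<open>w\<close> lies. If \<open>w\<close> is in \<open>\<Lambda>\<^sub>1\<close>, then
  \<open>v + w\<close> avoids \<open>\<Lambda>\<^sub>1\<close> and the minimality of
  \<open>\<mu>\<close> applies to it; if not, it applies to \<open>w\<close> itself.\<close>

lemma lattice_det_ge_chain: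
  fixes K \<Lambda> \<Lambda>\<^sub>1 :: "'a::euclidean_space set" and k :: nat
  assumes K: "o_symmetric_convex_body K" "interior K \<noteq> {}"
    and L: "is_lattice \<Lambda>" "dim \<Lambda> = DIM('a)" and L1: "is_lattice \<Lambda>\<^sub>1" "\<Lambda>\<^sub>1 \<subseteq> \<Lambda>"
    and l: "0 < l" "\<And>y t. \<lbrakk>y \<in> \<Lambda>; y \<noteq> 0; 0 \<le> t; y \<in> (*\<^sub>R) t ` K\<rbrakk> \<Longrightarrow> l \<le> t"
    and v: "v \<in> \<Lambda> - \<Lambda>\<^sub>1" "v \<in> (*\<^sub>R) \<mu> ` K"
    and \<mu>: "\<And>y t. \<lbrakk>y \<in> \<Lambda> - \<Lambda>\<^sub>1; 0 \<le> t; y \<in> (*\<^sub>R) t ` K\<rbrakk> \<Longrightarrow> \<mu> \<le> t"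
    and k: "real k * l \<le> \<mu>"
  shows "real k * ((l / 2) ^ DIM('a) * measure lebesgue K) \<le> lattice_det \<Lambda>"
proof (cases "k = 0")
  case True
  then show ?thesis by (simp add: lattice_det_def measure_nonneg)
next
  case False
  have "1 * l \<le> real k * l" using False l(1) by (intro mult_right_mono) auto
  then have "\<mu> > 0" using l(1) k by linarith
  have Ksym: "K = uminus ` K" and Kconv: "convex K" and Kcomp: "compact K"
    using K(1) by (simp_all add: o_symmetric_convex_body_def)
  have v_scaled: "r *\<^sub>R v \<in> (*\<^sub>R) (\<bar>r\<bar> * \<mu>) ` K" for r
  proof -
    obtain p where p: "v = \<mu> *\<^sub>R p" "p \<in> K" using v(2) by auto
    have "- p \<in> K" using p(2) Ksym by blast
    moreover have "r *\<^sub>R v = (\<bar>r\<bar> * \<mu>) *\<^sub>R (if r \<ge> 0 then p else - p)"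
      by (simp add: p(1))
    ultimately show ?thesis using p(2) by (metis imageI)
  qed
  \<comment> \<open>\<open>d i j w\<close> is the difference of the centres with indices
    \<open>i\<close> and \<open>j\<close>, shifted by \<open>w\<close>.\<close>
  define d where "d i j w = (real i * l / \<mu> - real j * l / \<mu>) *\<^sub>R v + w" for i j and w :: 'a
  have sep_inside: "\<not> j < i"
    if "i < k" "w \<in> \<Lambda>\<^sub>1" "0 \<le> t" "t < l" "d i j w \<in> (*\<^sub>R) t ` K" for i j w t
  proof
    assume "j < i"
    \<comment> \<open>Replacing the portion \<open>s *\<^sub>R v\<close> of \<open>v\<close> by the
      shorter \<open>d i j w\<close> yields \<open>v + w\<close>, a point outside
      \<open>\<Lambda>\<^sub>1\<close> of gauge at most \<open>t + (1 - s) * \<mu>\<close>. This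
      forces \<open>s * \<mu> \<le> t\<close>, although \<open>s * \<mu>\<close> is at least
      \<open>l\<close>.\<close>
    define s where "s = (real i - real j) * l / \<mu>"
    have "(real i - real j) * l \<le> real k * l"
      using \<open>i < k\<close> l(1) by (intro mult_right_mono) auto
    then have "s \<le> 1" using k \<open>\<mu> > 0\<close> by (simp add: s_def)
    have "d i j w = s *\<^sub>R v + w"
      by (simp add: d_def s_def left_diff_distrib diff_divide_distrib)
    then have "v + w = d i j w + (1 - s) *\<^sub>R v"
      by (simp add: algebra_simps)
    also have "\<dots> \<in> (*\<^sub>R) (t + \<bar>1 - s\<bar> * \<mu>) ` K"
      using that v_scaled \<open>\<mu> > 0\<close> by (intro scaled_body_add[OF Kconv]) auto
    finally have "v + w \<in> (*\<^sub>R) (t + (1 - s) * \<mu>) ` K" using \<open>s \<le> 1\<close> by simp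
    moreover have "v + w \<in> \<Lambda> - \<Lambda>\<^sub>1"
    proof -
      have "v + w \<in> \<Lambda>" using L(1) L1(2) v(1) that(2) by (auto simp: is_lattice_def)
      moreover have "v + w \<notin> \<Lambda>\<^sub>1"
        using is_lattice_diff[OF L1(1) _ that(2), of "v + w"] v(1) by auto
      ultimately show ?thesis by blast
    qed
    ultimately have "\<mu> \<le> t + (1 - s) * \<mu>"
      using \<mu> that(3) \<open>s \<le> 1\<close> \<open>\<mu> > 0\<close> by (auto simp: zero_le_mult_iff)
    then have "s * \<mu> \<le> t" by (simp add: algebra_simps)
    then have "(real i - real j) * l \<le> t" using \<open>\<mu> > 0\<close> by (simp add: s_def)
    moreover have "1 * l \<le> (real i - real j) * l"
      using \<open>j < i\<close> l(1) by (intro mult_right_mono) auto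
    ultimately show False using that by simp
  qed
  have sep: "i = j \<and> w = 0"
    if ij: "i < k" "j < k" and w: "w \<in> \<Lambda>" and t: "0 \<le> t" "t < l" "d i j w \<in> (*\<^sub>R) t ` K" for i j w t
  proof (cases "w \<in> \<Lambda>\<^sub>1")
    case True
    \<comment> \<open>Negation swaps the two indices, so both orders are excluded; with
      \<open>i = j\<close>, \<open>d i j w\<close> is \<open>w\<close> itself and the bound
      \<open>l\<close> gives \<open>w = 0\<close>.\<close>
    have "- w \<in> \<Lambda>\<^sub>1" using True L1(1) by (simp add: is_lattice_def)
    moreover have "d j i (- w) = - d i j w" by (simp add: d_def algebra_simps)
    ultimately have "\<not> i < j"
      using sep_inside[of j "- w" t i] scaled_body_uminus[OF Ksym t(3)] ij t by simp
    then have "i = j" using sep_inside[OF ij(1) True t] by simp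
    then show ?thesis using l(2)[of w t] w t by (auto simp: d_def)
  next
    case False
    define s where "s = (real j - real i) * l / \<mu>"
    have "w = d i j w + s *\<^sub>R v"
      by (simp add: d_def s_def algebra_simps diff_divide_distrib)
    also have "\<dots> \<in> (*\<^sub>R) (t + \<bar>s\<bar> * \<mu>) ` K"
      using t v_scaled \<open>\<mu> > 0\<close> by (intro scaled_body_add[OF Kconv]) auto
    finally have "\<mu> \<le> t + \<bar>s\<bar> * \<mu>"
      using \<mu>[of w] w False t(1) \<open>\<mu> > 0\<close> by simp
    also have "\<bar>s\<bar> * \<mu> = \<bar>real j - real i\<bar> * l"
      using \<open>\<mu> > 0\<close> l(1) by (simp add: s_def abs_mult)
    \<comment> \<open>Indices below \<open>k\<close> differ by at most \<open>k - 1\<close>; the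
      spare \<open>l\<close> absorbs \<open>t < l\<close>.\<close>
    also have "\<dots> \<le> (real k - 1) * l"
      using ij l(1) by (intro mult_right_mono) (auto simp: abs_le_iff)
    finally have "\<mu> < real k * l" using t(2) by (simp add: algebra_simps)
    then show ?thesis using k by simp
  qed
  \<comment> \<open>Interiors give strict separation, and they cost no volume since the frontier of
    a convex set is negligible.\<close>
  define U where "U i = (\<lambda>p. (l / 2) *\<^sub>R p + (real i * l / \<mu>) *\<^sub>R v) ` interior K" for i :: nat
  have U_sep: "i = j \<and> w = 0"
    if h: "i < k" "j < k" "w \<in> \<Lambda>" "x \<in> U i" "y \<in> U j" "x - y = w" for i j w x y
  proof -
    obtain p q where pq: "p \<in> interior K" "q \<in> interior K"
      "x = (l / 2) *\<^sub>R p + (real i * l / \<mu>) *\<^sub>R v" "y = (l / 2) *\<^sub>R q + (real j * l / \<mu>) *\<^sub>R v"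
      using h(4,5) unfolding U_def by blast
    obtain t r where t: "0 \<le> t" "t < 1" and r: "(1 / 2) *\<^sub>R (q - p) = t *\<^sub>R r" "r \<in> K"
      using interior_subset_scaled_body[OF interior_half_diff[OF K(1) pq(2,1)]] by (metis imageE)
    have "d i j (- w) = l *\<^sub>R (1 / 2) *\<^sub>R (q - p)"
      by (simp add: d_def h(6)[symmetric] pq algebra_simps)
    also have "\<dots> = (l * t) *\<^sub>R r"
      unfolding r(1) by simp
    also have "\<dots> \<in> (*\<^sub>R) (l * t) ` K"
      using r(2) by (rule imageI)
    finally have "i = j \<and> - w = 0"
      using h(1-3) t(1,2) l(1) L(1) by (intro sep[of i j "- w" "l * t"]) (auto simp: is_lattice_def)
    then show ?thesis by simp
  qed
  have bdd: "bounded K" using Kcomp by (rule compact_imp_bounded)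
  have U_meas: "measure lebesgue (U i) = (l / 2) ^ DIM('a) * measure lebesgue K" for i
    using measure_lebesgue_affine[of "l / 2" "(real i * l / \<mu>) *\<^sub>R v" "interior K"] l(1)
      measure_interior[OF bdd negligible_convex_frontier[OF Kconv]]
    by (simp add: U_def)
  have U_lmeas: "U i \<in> lmeasurable" for i
  proof -
    have "U i = (+) ((real i * l / \<mu>) *\<^sub>R v) ` (*\<^sub>R) (l / 2) ` interior K"
      by (simp add: U_def image_image add.commute)
    then show ?thesis
      using bounded_subset[OF bdd interior_subset] l(1)
      by (simp add: lmeasurable_open bounded_translation bounded_scaling open_translation open_scaling)
  qed
  have "measure lebesgue (\<Union>i<k. U i) = (\<Sum>i<k. measure lebesgue (U i))"
  proof (rule measure_UNION')
    show "pairwise (\<lambda>i j. disjnt (U i) (U j)) {..<k}"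
    proof (rule pairwiseI)
      fix i j assume "i \<in> {..<k}" "j \<in> {..<k}" "i \<noteq> j"
      then show "disjnt (U i) (U j)"
        using U_sep[of i j 0] L(1) unfolding disjnt_iff is_lattice_def by force
    qed
  qed (auto simp: U_lmeas)
  moreover have "measure lebesgue (\<Union>i<k. U i) \<le> lattice_det \<Lambda>"
  proof (rule measure_le_lattice_det[OF L])
    show "(\<Union>i<k. U i) \<in> lmeasurable"
      using U_lmeas by (intro fmeasurable.finite_UN) auto
    show "w = 0" if "w \<in> \<Lambda>" "x \<in> (\<Union>i<k. U i)" "y \<in> (\<Union>i<k. U i)" "x - y = w" for w x y
      using that U_sep by (metis UN_E lessThan_iff)
  qed
  ultimately show ?thesis by (simp add: U_meas)
qed

section \<open>From the packing inequality to the bound on the restricted minimum\<close>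

theorem corollary1p3:
  fixes K \<Lambda> \<Lambda>\<^sub>1 :: "(real ^ 'n) set"
  assumes "CARD('n) \<ge> 2"
    and "o_symmetric_convex_body K" and "interior K \<noteq> {}"
    and "is_lattice \<Lambda>" and "dim \<Lambda> = CARD('n)"
    and "is_lattice \<Lambda>\<^sub>1" and "\<Lambda>\<^sub>1 \<subset> \<Lambda>" and "dim \<Lambda>\<^sub>1 = CARD('n)"
  shows "successive_min 1 K (\<Lambda> - \<Lambda>\<^sub>1)
       \<le> 2 ^ CARD('n) * lattice_det \<Lambda>
           / (successive_min 1 K \<Lambda>\<^sub>1 ^ (CARD('n) - 1) * measure lebesgue K)
         + successive_min 1 K \<Lambda>"
proof -
  note K = assms(2,3) and L = assms(4,5) and L1 = assms(6)
  define l where "l = successive_min 1 K \<Lambda>"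
  define l1 where "l1 = successive_min 1 K \<Lambda>\<^sub>1"
  define \<mu> where "\<mu> = successive_min 1 K (\<Lambda> - \<Lambda>\<^sub>1)"
  define V where "V = measure lebesgue K"
  have "0 \<in> \<Lambda>\<^sub>1" using L1 by (simp add: is_lattice_def)
  \<comment> \<open>Nonzero points of \<open>\<Lambda> - \<Lambda>\<^sub>1\<close> and of
    \<open>\<Lambda>\<^sub>1\<close> are what guarantees that the minima are attained.\<close>
  obtain a where a: "a \<in> \<Lambda> - \<Lambda>\<^sub>1" "a \<noteq> 0" using assms(7) \<open>0 \<in> \<Lambda>\<^sub>1\<close> by blast
  have "\<not> \<Lambda>\<^sub>1 \<subseteq> {0}" using assms(1,8) by (auto simp flip: dim_eq_0)
  then obtain b where b: "b \<in> \<Lambda>\<^sub>1" "b \<noteq> 0" by blast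
  obtain x where x: "x \<in> \<Lambda>" "x \<noteq> 0" "x \<in> (*\<^sub>R) l ` K" "0 < l"
    "\<And>y t. \<lbrakk>y \<in> \<Lambda>; y \<noteq> 0; 0 \<le> t; y \<in> (*\<^sub>R) t ` K\<rbrakk> \<Longrightarrow> l \<le> t"
    unfolding l_def using successive_min_one_attained[OF K L(1) order_refl, of a] a by blast
  obtain x1 where x1: "x1 \<in> \<Lambda>\<^sub>1" "x1 \<noteq> 0" "x1 \<in> (*\<^sub>R) l1 ` K" "0 < l1"
    "\<And>y t. \<lbrakk>y \<in> \<Lambda>\<^sub>1; y \<noteq> 0; 0 \<le> t; y \<in> (*\<^sub>R) t ` K\<rbrakk> \<Longrightarrow> l1 \<le> t"
    unfolding l1_def using successive_min_one_attained[OF K L1 order_refl b] by blast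
  obtain v where v: "v \<in> \<Lambda> - \<Lambda>\<^sub>1" "v \<noteq> 0" "v \<in> (*\<^sub>R) \<mu> ` K" "0 < \<mu>"
    "\<And>y t. \<lbrakk>y \<in> \<Lambda> - \<Lambda>\<^sub>1; y \<noteq> 0; 0 \<le> t; y \<in> (*\<^sub>R) t ` K\<rbrakk> \<Longrightarrow> \<mu> \<le> t"
    unfolding \<mu>_def using successive_min_one_attained[OF K L(1) Diff_subset a] by blast
  have "K \<in> lmeasurable" "\<not> negligible K"
    using K by (auto simp: o_symmetric_convex_body_def lmeasurable_compact negligible_convex_interior)
  then have "V > 0"
    unfolding V_def by (simp add: negligible_iff_measure zero_less_measure_iff)
  have "\<mu> \<le> 2 ^ CARD('n) * lattice_det \<Lambda> / (l1 ^ (CARD('n) - 1) * V) + l"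
  proof (cases "x \<in> \<Lambda>\<^sub>1")
    case False
    then have "\<mu> \<le> l" using v(5)[of x l] x by simp
    moreover have "0 \<le> 2 ^ CARD('n) * lattice_det \<Lambda> / (l1 ^ (CARD('n) - 1) * V)"
      using \<open>V > 0\<close> x1(4) by (simp add: lattice_det_def measure_nonneg)
    ultimately show ?thesis by simp
  next
    case True
    have "l1 \<le> l" using x1(5)[OF True] x by simp
    moreover have "l \<le> l1" using x(5)[of x1 l1] x1 assms(7) by auto
    ultimately have "l1 = l" by simp
    define k where "k = nat \<lfloor>\<mu> / l\<rfloor>"
    have "real k = of_int \<lfloor>\<mu> / l\<rfloor>" using v(4) x(4) by (simp add: k_def)
    then have "real k \<le> \<mu> / l" "\<mu> / l < real k + 1" by linarith+
    then have k: "real k * l \<le> \<mu>" "\<mu> - l \<le> real k * l"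
      using x(4) by (simp_all add: field_simps)
    have "\<mu> \<le> t" if "y \<in> \<Lambda> - \<Lambda>\<^sub>1" "0 \<le> t" "y \<in> (*\<^sub>R) t ` K" for y t
      using v(5)[OF that(1) _ that(2,3)] that(1) \<open>0 \<in> \<Lambda>\<^sub>1\<close> by blast
    then have "real k * ((l / 2) ^ CARD('n) * V) \<le> lattice_det \<Lambda>"
      using lattice_det_ge_chain[OF K L(1) _ L1 _ x(4,5) v(1,3) _ k(1)] L(2) assms(7)
      by (simp add: V_def psubset_imp_subset)
    \<comment> \<open>One factor \<open>l\<close> joins \<open>k\<close> to form
      \<open>k * l\<close>, which is compared with \<open>\<mu> - l\<close>; the other factors
      become the power of \<open>l1\<close> in the denominator.\<close>
    moreover have "l ^ CARD('n) = l * l ^ (CARD('n) - 1)"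
      using assms(1) by (cases "CARD('n)") auto
    ultimately have "real k * l * (l ^ (CARD('n) - 1) * V) \<le> 2 ^ CARD('n) * lattice_det \<Lambda>"
      by (simp add: power_divide field_simps)
    then have "real k * l \<le> 2 ^ CARD('n) * lattice_det \<Lambda> / (l ^ (CARD('n) - 1) * V)"
      using \<open>V > 0\<close> x(4) by (simp add: pos_le_divide_eq)
    then show ?thesis using k(2) \<open>l1 = l\<close> by simp
  qed
  then show ?thesis by (simp add: l_def l1_def \<mu>_def V_def)
qed

end
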